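(* Let $\Sigma=\Sigma^{(1)}\otimes\Sigma^{(2)}$ be the Kronecker product of two positive definite $2\times 2$ matrices $\Sigma^{(1)},\Sigma^{(2)}$. Let $f(x)=x_1x_4-x_2x_3$ for $x=(x_1,x_2,x_3,x_4)\in\mathbb{R}^4$. Then $W_{f,\Sigma}$ has the same distribution as $$\tfrac14 R^2U^2,$$ where $R^2\sim\chi^2_4$ and $U\sim\operatorname{Uniform}[0,1]$ are independent.
   Context: For a homogeneous polynomial $f\in\mathbb{R}[x_1,\dots,x_k]$ with gradient $\nabla f$ and a positive semidefinite $k\times k$ matrix $\Sigma$, define $$W_{f,\Sigma}=\frac{f(X)^2}{(\nabla f(X))^T\,\Sigma\,\nabla f(X)},\qquad X\sim\mathcal{N}_k(0,\Sigma).$$ Here $k=4$. The Kronecker product of $P=(p_{ij})\in\mathbb{R}^{2\times2}$ and $Q\in\mathbb{R}^{2\times 2}$ is the $4\times4$ block matrix with $(i,j)$ block $p_{ij}Q$. $\chi^2_4$ is the chi-square distribution with four degrees of freedom. *)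

theory Defs
  imports "HOL-Probability.Probability"
begin

definition pos_def_matrix :: "real ^ 'n ^ 'n \<Rightarrow> bool" where
  "pos_def_matrix A \<longleftrightarrow> transpose A = A \<and> (\<forall>x. x \<noteq> 0 \<longrightarrow> 0 < x \<bullet> (A *v x))"

(* In the numeral type 4 the indices are 1, 2, 3, 4, where 4 = 0.  The index 2(i-1)+j of R^4
   has block number i and position j inside the block. *)
definition block_index :: "4 \<Rightarrow> 2" where
  "block_index r = (if r = 1 \<or> r = 2 then 1 else 2)"

definition inner_index :: "4 \<Rightarrow> 2" where
  "inner_index r = (if r = 1 \<or> r = 3 then 1 else 2)"

definition kronecker :: "real ^ 2 ^ 2 \<Rightarrow> real ^ 2 ^ 2 \<Rightarrow> real ^ 4 ^ 4" where
  "kronecker P Q =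
     (\<chi> r c. P $ block_index r $ block_index c * Q $ inner_index r $ inner_index c)"

lemma kronecker_explicit:
  "kronecker P Q = vector
     [vector [P$1$1 * Q$1$1, P$1$1 * Q$1$2, P$1$2 * Q$1$1, P$1$2 * Q$1$2],
      vector [P$1$1 * Q$2$1, P$1$1 * Q$2$2, P$1$2 * Q$2$1, P$1$2 * Q$2$2],
      vector [P$2$1 * Q$1$1, P$2$1 * Q$1$2, P$2$2 * Q$1$1, P$2$2 * Q$1$2],
      vector [P$2$1 * Q$2$1, P$2$1 * Q$2$2, P$2$2 * Q$2$1, P$2$2 * Q$2$2]]"
  by (simp add: vec_eq_iff forall_4 kronecker_def block_index_def inner_index_def vector_def)

(* Meaningful where f is differentiable; the gradient is then unique. *)
definition gradient :: "('a::real_inner \<Rightarrow> real) \<Rightarrow> 'a \<Rightarrow> 'a" where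
  "gradient f x = (THE D. GDERIV f x :> D)"

lemma gradient_eqI:
  assumes "GDERIV f x :> D"
  shows "gradient f x = D"
  unfolding gradient_def
proof (rule the_equality)
  show "GDERIV f x :> D" by (rule assms)
next
  fix E assume "GDERIV f x :> E"
  then have "(\<lambda>h. h \<bullet> E) = (\<lambda>h. h \<bullet> D)"
    using assms unfolding gderiv_def by (rule has_derivative_unique)
  then have "(E - D) \<bullet> (E - D) = 0"
    by (metis (no_types, lifting) inner_diff_right right_minus_eq)
  then show "E = D" by simp
qed

definition std_normal_vec :: "(real ^ 'n) measure" where
  "std_normal_vec = density lborel (\<lambda>x. ennreal (\<Prod>i\<in>UNIV. std_normal_density (x $ i)))"

(* N(mu, Sigma), as the law of mu + A Z with Z standard normal and A A^T = Sigma.  This covers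
   every positive semidefinite Sigma, singular ones included, and the law does not depend on
   the choice of A. *)
definition multivariate_normal ::
    "'a measure \<Rightarrow> real ^ 'n \<Rightarrow> real ^ 'n ^ 'n \<Rightarrow> ('a \<Rightarrow> real ^ 'n) \<Rightarrow> bool" where
  "multivariate_normal M \<mu> \<Sigma> X \<longleftrightarrow>
     X \<in> borel_measurable M \<and>
     (\<exists>A :: real ^ 'n ^ 'n. A ** transpose A = \<Sigma> \<and>
        distr M borel X = distr std_normal_vec borel (\<lambda>z. \<mu> + A *v z))"

(* The random variable is wald f Sigma (X w) with X normal.  Where the denominator vanishes the
   value is 0, by the convention for division. *)
definition wald :: "(real ^ 'n \<Rightarrow> real) \<Rightarrow> real ^ 'n ^ 'n \<Rightarrow> real ^ 'n \<Rightarrow> real" where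
  "wald f \<Sigma> x = (f x)\<^sup>2 / (gradient f x \<bullet> (\<Sigma> *v gradient f x))"

definition chi_square_density :: "nat \<Rightarrow> real \<Rightarrow> real" where
  "chi_square_density k x =
     (if x > 0
      then x powr (real k / 2 - 1) * exp (- x / 2) / (2 powr (real k / 2) * Gamma (real k / 2))
      else 0)"

end

theory Submission
  imports Defs
begin

text \<open>
  Read \<open>x \<in> \<real>\<^sup>4\<close> as a \<open>2 \<times> 2\<close> matrix, so that \<open>f\<close> is the determinant. Choose invertible \<open>L\<^sub>i\<close>
  with \<open>L\<^sub>i L\<^sub>i\<^sup>T = \<Sigma>\<^sub>i\<close> and put \<open>L = L\<^sub>1 \<otimes> L\<^sub>2\<close>. The substitution \<open>x = L y\<close> multiplies the determinant by
  \<open>c = det L\<^sub>1 det L\<^sub>2\<close>. The gradient of \<open>f\<close> is an isometric linear map \<open>J\<close>, the cofactor map, and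
  \<open>L\<^sup>T J L = c J\<close>. Hence \<open>\<Sigma>\<close> drops out: the statistic at \<open>L y\<close> equals \<open>f(y)\<^sup>2 / |y|\<^sup>2\<close>
  (\<open>wald_det_form_kronecker\<close>). If \<open>X\<close> has the law of \<open>A Z\<close> with \<open>A A\<^sup>T = \<Sigma>\<close>, then \<open>A = L Q\<close> with \<open>Q\<close>
  orthogonal, and the standard normal law is invariant under \<open>Q\<close>, so one may take \<open>y = Z\<close>
  (\<open>distr_wald_det_form\<close>).

  A further orthogonal change of coordinates turns \<open>f(Z)\<close> into \<open>(P - P') / 2\<close> and \<open>|Z|\<^sup>2\<close> into
  \<open>P + P'\<close>, where \<open>P = Z\<^sub>1\<^sup>2 + Z\<^sub>2\<^sup>2\<close> and \<open>P' = Z\<^sub>3\<^sup>2 + Z\<^sub>4\<^sup>2\<close> in the new coordinates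
  (\<open>distr_std_normal_vec_det_form\<close>). Since
  \<open>|x|\<^sup>2\<close> carries Lebesgue measure of the plane to \<open>\<pi>\<close> times Lebesgue measure on \<open>[0, \<infinity>)\<close>, the
  variables \<open>P\<close> and \<open>P'\<close> are independent exponentials of rate \<open>1 / 2\<close>
  (\<open>nn_integral_std_normal_vec_4\<close>). Therefore \<open>S = P + P'\<close> is chi-square with four degrees of
  freedom, \<open>V = (P - P') / S\<close> is uniform on \<open>[-1, 1]\<close> and independent of \<open>S\<close>, and the statistic
  is \<open>(P - P')\<^sup>2 / (4 S) = S V\<^sup>2 / 4\<close>; only \<open>|V|\<close>, which is uniform on \<open>[0, 1]\<close>, matters
  (\<open>nn_integral_quadrant_sum_ratio\<close>).
\<close>

section \<open>Lebesgue measure on the plane and on four-space\<close>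

lemma borel_measurable_nth_cart [measurable]:
  "(\<lambda>z :: real ^ 'n. z $ i) \<in> borel_measurable borel"
  by (intro borel_measurable_continuous_onI continuous_intros)

lemma norm_sq_4: "(norm z)\<^sup>2 = ((z $ 1)\<^sup>2 + (z $ 2)\<^sup>2) + ((z $ 3)\<^sup>2 + (z $ 4)\<^sup>2)" for z :: "real ^ 4"
  unfolding power2_norm_eq_inner inner_vec_def sum_4 by (simp add: power2_eq_square)

lemma prod_Basis_prod:
  "(\<Prod>b\<in>Basis. f (b :: 'a::euclidean_space \<times> 'b::euclidean_space))
     = (\<Prod>a\<in>Basis. f (a, 0)) * (\<Prod>b\<in>Basis. f (0, b))"
proof -
  have "(\<lambda>u :: 'a. (u, 0 :: 'b)) ` Basis \<inter> (\<lambda>u :: 'b. (0 :: 'a, u)) ` Basis = {}"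
    by auto
  then show ?thesis
    unfolding Basis_prod_def by (subst prod.union_disjoint) (auto simp: prod.reindex inj_on_def)
qed

lemma ball_Basis_prod:
  "(\<forall>b\<in>Basis. P (b :: 'a::euclidean_space \<times> 'b::euclidean_space))
     \<longleftrightarrow> (\<forall>a\<in>Basis. P (a, 0)) \<and> (\<forall>b\<in>Basis. P (0, b))"
  unfolding Basis_prod_def by auto

lemma lborel_split_4:
  "distr (lborel :: (real ^ 4) measure) borel (\<lambda>z. ((z $ 1, z $ 2), (z $ 3, z $ 4))) = lborel"
proof (rule lborel_eqI[symmetric])
  let ?S = "\<lambda>z :: real ^ 4. ((z $ 1, z $ 2), (z $ 3, z $ 4))"
  have [measurable]: "?S \<in> borel_measurable borel"
    by (intro borel_measurable_continuous_onI continuous_intros)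
  fix l u :: "(real \<times> real) \<times> real \<times> real"
  assume le: "\<And>b. b \<in> Basis \<Longrightarrow> l \<bullet> b \<le> u \<bullet> b"
  obtain l1 l2 l3 l4 where l: "l = ((l1, l2), (l3, l4))" by (metis surj_pair)
  obtain u1 u2 u3 u4 where u: "u = ((u1, u2), (u3, u4))" by (metis surj_pair)
  have le': "l1 \<le> u1" "l2 \<le> u2" "l3 \<le> u3" "l4 \<le> u4"
    using le[of "((1,0),(0,0))"] le[of "((0,1),(0,0))"] le[of "((0,0),(1,0))"] le[of "((0,0),(0,1))"]
    by (simp_all add: l u Basis_prod_def zero_prod_def)
  define l' u' :: "real ^ 4" where
    "l' = (\<chi> i. if i = 1 then l1 else if i = 2 then l2 else if i = 3 then l3 else l4)" and
    "u' = (\<chi> i. if i = 1 then u1 else if i = 2 then u2 else if i = 3 then u3 else u4)"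
  have Basis4: "(\<Prod>b\<in>Basis. (g :: real ^ 4) \<bullet> b) = g $ 1 * g $ 2 * g $ 3 * g $ 4" for g
  proof -
    have "bij_betw (\<lambda>i :: 4. axis i (1 :: real)) UNIV Basis"
      by (auto simp: bij_betw_def inj_on_def axis_eq_axis Basis_vec_def)
    from prod.reindex_bij_betw[OF this, of "\<lambda>b. g \<bullet> b"]
    have "(\<Prod>b\<in>Basis. g \<bullet> b) = (\<Prod>i\<in>UNIV. g $ i)"
      by (simp add: inner_axis)
    also have "\<dots> = g $ 1 * g $ 2 * g $ 3 * g $ 4"
      unfolding UNIV_4 by (simp add: mult.assoc)
    finally show ?thesis .
  qed
  have pre: "?S -` box l u = box l' u'"
    by (auto simp: mem_box_cart mem_box ball_Basis_prod forall_4 l u l'_def u'_def)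
  have "emeasure (distr lborel borel ?S) (box l u) = emeasure lborel (box l' u')"
    by (simp add: emeasure_distr pre)
  also have "\<dots> = (\<Prod>b\<in>Basis. (u' - l') \<bullet> b)"
  proof (rule emeasure_lborel_box)
    fix b :: "real ^ 4" assume "b \<in> Basis"
    then show "l' \<bullet> b \<le> u' \<bullet> b"
      using le' by (auto simp: Basis_vec_def inner_axis l'_def u'_def)
  qed
  also have "\<dots> = (u1 - l1) * (u2 - l2) * (u3 - l3) * (u4 - l4)"
    by (simp only: Basis4) (simp add: l'_def u'_def)
  also have "\<dots> = (\<Prod>b\<in>Basis. (u - l) \<bullet> b)"
    by (simp add: prod_Basis_prod l u mult.assoc)
  finally show "emeasure (distr lborel borel ?S) (box l u) = (\<Prod>b\<in>Basis. (u - l) \<bullet> b)" .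
qed simp

text \<open>
  Polar coordinates in the plane with the angle integrated out: the disc \<open>|x|\<^sup>2 \<le> s\<close> has area \<open>\<pi> s\<close>.
\<close>
lemma distr_norm_sq_plane:
  "distr (lborel :: (real \<times> real) measure) borel (\<lambda>x. (norm x)\<^sup>2)
     = density lborel (\<lambda>s. ennreal pi * indicator {0..} s)"
    (is "?M = ?D")
proof (rule measure_eqI_generator_eq[where E = "range atMost" and \<Omega> = UNIV and A = "\<lambda>n :: nat. {..real n}"])
  have eq: "emeasure ?M {..a} = ennreal (pi * max 0 a)" "emeasure ?D {..a} = ennreal (pi * max 0 a)" for a
  proof -
    have "(\<lambda>x :: real \<times> real. (norm x)\<^sup>2) -` {..a} = (if a \<ge> 0 then cball 0 (sqrt a) else {})"
    proof (cases "a \<ge> 0")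
      case True
      have "(norm x)\<^sup>2 \<le> a \<longleftrightarrow> norm x \<le> sqrt a" for x :: "real \<times> real"
        by (metis abs_norm_cancel real_sqrt_abs real_sqrt_le_iff)
      with True show ?thesis by (auto simp: set_eq_iff)
    next
      case False
      then have "\<not> (norm x)\<^sup>2 \<le> a" for x :: "real \<times> real"
        using zero_le_power2[of "norm x"] by linarith
      with False show ?thesis by auto
    qed
    then show "emeasure ?M {..a} = ennreal (pi * max 0 a)"
      by (simp add: emeasure_distr emeasure_cball unit_ball_vol_2)
    have "emeasure ?D {..a} = (\<integral>\<^sup>+s. ennreal pi * indicator {0..a} s \<partial>lborel)"
      by (subst emeasure_density) (auto intro!: nn_integral_cong split: split_indicator)
    also have "\<dots> = ennreal (pi * max 0 a)"
      by (cases "a \<ge> 0") (simp_all add: nn_integral_cmult ennreal_mult')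
    finally show "emeasure ?D {..a} = ennreal (pi * max 0 a)" .
  qed
  show "emeasure ?M X = emeasure ?D X" if "X \<in> range atMost" for X
    using that eq by auto
  show "sets ?M = sigma_sets UNIV (range atMost)" "sets ?D = sigma_sets UNIV (range atMost)"
    by (simp_all add: borel_eq_atMost)
  show "emeasure ?M {..real n} \<noteq> \<infinity>" for n
    by (simp add: eq)
  show "(\<Union>n :: nat. {..real n}) = UNIV"
    using real_arch_simple by auto
  show "Int_stable (range atMost :: real set set)"
    by (auto simp: Int_stable_def)
qed auto

lemma nn_integral_norm_sq_plane:
  assumes [measurable]: "g \<in> borel_measurable borel"
  shows "(\<integral>\<^sup>+x. g ((norm (x :: real \<times> real))\<^sup>2) \<partial>lborel)
           = ennreal pi * (\<integral>\<^sup>+s. g s * indicator {0..} s \<partial>lborel)"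
proof -
  have "(\<integral>\<^sup>+x. g ((norm (x :: real \<times> real))\<^sup>2) \<partial>lborel)
      = (\<integral>\<^sup>+s. g s \<partial>distr (lborel :: (real \<times> real) measure) borel (\<lambda>x. (norm x)\<^sup>2))"
    by (simp add: nn_integral_distr)
  also have "\<dots> = (\<integral>\<^sup>+s. ennreal pi * (g s * indicator {0..} s) \<partial>lborel)"
    unfolding distr_norm_sq_plane by (subst nn_integral_density) (auto simp: mult_ac)
  finally show ?thesis by (simp add: nn_integral_cmult)
qed

section \<open>Invariance of the standard normal law under orthogonal maps\<close>

lemma orthogonal_transformation_borel_measurable:
  fixes f :: "'a::euclidean_space \<Rightarrow> 'a"
  assumes "orthogonal_transformation f"
  shows "f \<in> borel_measurable borel"
  by (intro borel_measurable_continuous_onI linear_continuous_on linear_linear[THEN iffD2]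
      orthogonal_transformation_linear assms)

lemma distr_lborel_orthogonal:
  fixes f :: "real ^ 'n::{finite,wellorder} \<Rightarrow> real ^ 'n::_"
  assumes "orthogonal_transformation f"
  shows "distr lborel borel f = lborel"
proof (rule lborel_eqI[symmetric])
  have f [measurable]: "f \<in> borel_measurable borel"
    using assms by (rule orthogonal_transformation_borel_measurable)
  have inv: "orthogonal_transformation (inv f)" "bij f"
    using assms by (auto simp: orthogonal_transformation_inv orthogonal_transformation_bij)
  fix l u :: "real ^ 'n::_" assume le: "\<And>b. b \<in> Basis \<Longrightarrow> l \<bullet> b \<le> u \<bullet> b"
  have pre: "f -` box l u \<in> sets borel"
    using measurable_sets[OF f, of "box l u"] by simp
  have "emeasure (distr lborel borel f) (box l u) = emeasure lborel (f -` box l u)"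
    by (simp add: emeasure_distr)
  also have "\<dots> = emeasure lebesgue (f -` box l u)"
    using pre by simp
  also have "f -` box l u = inv f ` box l u"
    using inv(2) by (simp add: bij_vimage_eq_inv_image)
  also have "emeasure lebesgue (inv f ` box l u) = ennreal (measure lebesgue (inv f ` box l u))"
    using measurable_orthogonal_image[OF inv(1), of "box l u"] by (intro emeasure_eq_measure2) auto
  also have "\<dots> = ennreal (measure lebesgue (box l u))"
    using measure_orthogonal_image[OF inv(1), of "box l u"] by simp
  also have "\<dots> = (\<Prod>b\<in>Basis. (u - l) \<bullet> b)"
    using le by (simp add: measure_lborel_box)
  finally show "emeasure (distr lborel borel f) (box l u) = (\<Prod>b\<in>Basis. (u - l) \<bullet> b)" .
qed simp

lemma std_normal_vec_eq_exp_norm: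
  "(std_normal_vec :: (real ^ 'n) measure)
     = density lborel (\<lambda>x. ennreal (exp (- (norm x)\<^sup>2 / 2) / sqrt (2 * pi) ^ CARD('n)))"
proof -
  have "(\<Prod>i\<in>UNIV. std_normal_density (x $ i)) = exp (- (norm x)\<^sup>2 / 2) / sqrt (2 * pi) ^ CARD('n)"
    for x :: "real ^ 'n"
  proof -
    have "(\<Prod>i\<in>UNIV. std_normal_density (x $ i))
        = (1 / sqrt (2 * pi)) ^ CARD('n) * exp (\<Sum>i\<in>UNIV. - (x $ i)\<^sup>2 / 2)"
      by (simp only: std_normal_density_def prod.distrib exp_sum finite prod_constant)
    also have "(\<Sum>i\<in>UNIV. - (x $ i)\<^sup>2 / 2) = - (norm x)\<^sup>2 / 2"
    proof -
      have "(norm x)\<^sup>2 = (\<Sum>i\<in>UNIV. (x $ i)\<^sup>2)"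
        unfolding power2_norm_eq_inner inner_vec_def inner_real_def by (simp add: power2_eq_square)
      then show ?thesis by (simp only: sum_divide_distrib[symmetric] sum_negf)
    qed
    finally show ?thesis by (simp add: power_divide)
  qed
  then show ?thesis by (simp add: std_normal_vec_def)
qed

lemma distr_std_normal_vec_orthogonal:
  fixes f :: "real ^ 'n::{finite,wellorder} \<Rightarrow> real ^ 'n::_"
  assumes "orthogonal_transformation f"
  shows "distr std_normal_vec borel f = std_normal_vec"
proof -
  have [measurable]: "f \<in> borel_measurable borel"
    using assms by (rule orthogonal_transformation_borel_measurable)
  let ?d = "\<lambda>x :: real ^ 'n::_. ennreal (exp (- (norm x)\<^sup>2 / 2) / sqrt (2 * pi) ^ CARD('n))"
  have "std_normal_vec = density (distr lborel borel f) ?d"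
    by (simp add: std_normal_vec_eq_exp_norm distr_lborel_orthogonal[OF assms])
  also have "\<dots> = distr (density lborel (\<lambda>x. ?d (f x))) borel f"
    by (rule density_distr) auto
  also have "(\<lambda>x. ?d (f x)) = ?d"
    using assms by (simp add: orthogonal_transformation_norm)
  finally show ?thesis by (simp add: std_normal_vec_eq_exp_norm)
qed

section \<open>Sums of squares of standard normal coordinates\<close>

text \<open>
  The sums of the first two and of the last two squared coordinates are independent, each with
  density \<open>exp (- p / 2) / 2\<close> on \<open>[0, \<infinity>)\<close>.
\<close>
lemma nn_integral_std_normal_vec_4:
  assumes [measurable]: "F \<in> borel_measurable (borel \<Otimes>\<^sub>M borel)"
  shows "(\<integral>\<^sup>+z. F ((z $ 1)\<^sup>2 + (z $ 2)\<^sup>2, (z $ 3)\<^sup>2 + (z $ 4)\<^sup>2) \<partial>(std_normal_vec :: (real ^ 4) measure))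
    = (\<integral>\<^sup>+p. \<integral>\<^sup>+q. F (p, q) * ennreal (exp (- (p + q) / 2) / 4)
         * indicator {0..} p * indicator {0..} q \<partial>lborel \<partial>lborel)"
proof -
  define G where "G = (\<lambda>(p, q). ennreal (exp (- (p + q) / 2) / (4 * pi\<^sup>2)) * F (p, q))"
  have G [measurable]: "G \<in> borel_measurable (borel \<Otimes>\<^sub>M borel)"
    unfolding G_def by measurable
  let ?S = "\<lambda>z :: real ^ 4. ((z $ 1, z $ 2), (z $ 3, z $ 4))"
  have S [measurable]: "?S \<in> borel_measurable borel"
    by (intro borel_measurable_continuous_onI continuous_intros)
  have H: "(\<lambda>x. G ((norm (fst x))\<^sup>2, (norm (snd x))\<^sup>2))
      \<in> borel_measurable (borel :: ((real \<times> real) \<times> real \<times> real) measure)"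
    by (intro measurable_compose[OF measurable_Pair G] borel_measurable_continuous_onI continuous_intros)
  have sqrt4: "sqrt (2 * pi) ^ 4 = 4 * pi\<^sup>2"
    by (simp add: power4_eq_xxxx power2_eq_square)
  have card4: "CARD(4) = 4" by simp
  have norm2: "(norm (a, b))\<^sup>2 = a\<^sup>2 + b\<^sup>2" for a b :: real
    by (simp add: norm_Pair)
  have "(\<integral>\<^sup>+z. F ((z $ 1)\<^sup>2 + (z $ 2)\<^sup>2, (z $ 3)\<^sup>2 + (z $ 4)\<^sup>2) \<partial>(std_normal_vec :: (real ^ 4) measure))
      = (\<integral>\<^sup>+z. G ((norm (fst (?S z)))\<^sup>2, (norm (snd (?S z)))\<^sup>2) \<partial>lborel)"
    unfolding std_normal_vec_eq_exp_norm
    by (subst nn_integral_density) (simp_all only: G_def card4 sqrt4 norm_sq_4 norm2 fst_conv snd_conv case_prod_conv, measurable)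
  also have "\<dots> = (\<integral>\<^sup>+x. G ((norm (fst x))\<^sup>2, (norm (snd x))\<^sup>2) \<partial>distr lborel borel ?S)"
    using H S by (subst nn_integral_distr) auto
  also have "\<dots> = (\<integral>\<^sup>+x. G ((norm (fst x))\<^sup>2, (norm (snd x))\<^sup>2)
      \<partial>((lborel :: (real \<times> real) measure) \<Otimes>\<^sub>M (lborel :: (real \<times> real) measure)))"
    unfolding lborel_split_4 lborel_prod ..
  also have "\<dots> = (\<integral>\<^sup>+x. \<integral>\<^sup>+y. G ((norm (x :: real \<times> real))\<^sup>2, (norm (y :: real \<times> real))\<^sup>2) \<partial>lborel \<partial>lborel)"
    by (subst lborel.nn_integral_fst[symmetric]) simp_all
  also have "\<dots> = (\<integral>\<^sup>+x. ennreal pi * (\<integral>\<^sup>+q. G ((norm (x :: real \<times> real))\<^sup>2, q) * indicator {0..} q \<partial>lborel) \<partial>lborel)"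
    by (subst nn_integral_norm_sq_plane[symmetric]) simp_all
  also have "\<dots> = ennreal pi * (\<integral>\<^sup>+p. (ennreal pi * (\<integral>\<^sup>+q. G (p, q) * indicator {0..} q \<partial>lborel))
      * indicator {0..} p \<partial>lborel)"
    by (rule nn_integral_norm_sq_plane) measurable
  also have "\<dots> = (\<integral>\<^sup>+p. \<integral>\<^sup>+q. ennreal pi * (ennreal pi * (G (p, q) * indicator {0..} q)
      * indicator {0..} p) \<partial>lborel \<partial>lborel)"
    by (simp add: nn_integral_cmult nn_integral_multc)
  finally have integral: "(\<integral>\<^sup>+z. F ((z $ 1)\<^sup>2 + (z $ 2)\<^sup>2, (z $ 3)\<^sup>2 + (z $ 4)\<^sup>2)
      \<partial>(std_normal_vec :: (real ^ 4) measure))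
    = (\<integral>\<^sup>+p. \<integral>\<^sup>+q. ennreal pi * (ennreal pi * (G (p, q) * indicator {0..} q)
      * indicator {0..} p) \<partial>lborel \<partial>lborel)" .
  have "ennreal pi * (ennreal pi * (G (p, q) * indicator {0..} q) * indicator {0..} p)
      = F (p, q) * ennreal (exp (- (p + q) / 2) / 4) * indicator {0..} p * indicator {0..} q" for p q
  proof -
    have "ennreal pi * (ennreal pi * ennreal (exp (- (p + q) / 2) / (4 * pi\<^sup>2)))
        = ennreal (exp (- (p + q) / 2) / 4)"
      by (simp add: ennreal_mult'[symmetric] power2_eq_square)
    then show ?thesis
      unfolding G_def by (auto split: split_indicator simp: mult_ac) (metis mult.left_commute)
  qed
  then show ?thesis unfolding integral by simp
qed

text \<open>
  The substitution \<open>s = p + q\<close>, \<open>u = (p - q) / (p + q)\<close>, for which \<open>dp dq = s / 2 du ds\<close>. The argument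
  of \<open>\<psi>\<close> is even in \<open>u\<close>, so \<open>[-1, 1]\<close> folds onto \<open>[0, 1]\<close>, and the density that remains is that
  of \<open>s\<close> alone.
\<close>
lemma nn_integral_quadrant_sum_ratio:
  assumes [measurable]: "\<psi> \<in> borel_measurable borel"
  shows "(\<integral>\<^sup>+p. \<integral>\<^sup>+q. \<psi> ((p - q)\<^sup>2 / (4 * (p + q))) * ennreal (exp (- (p + q) / 2) / 4)
         * indicator {0..} p * indicator {0..} q \<partial>lborel \<partial>lborel)
    = (\<integral>\<^sup>+s. \<integral>\<^sup>+u. \<psi> (1 / 4 * s * u\<^sup>2) * ennreal (chi_square_density 4 s)
         * indicator {0..1} u \<partial>lborel \<partial>lborel)"
proof -
  let ?f = "\<lambda>p q. \<psi> ((p - q)\<^sup>2 / (4 * (p + q))) * ennreal (exp (- (p + q) / 2) / 4)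
         * indicator {0..} p * indicator {0..} q"
  have "(\<integral>\<^sup>+p. \<integral>\<^sup>+q. ?f p q \<partial>lborel \<partial>lborel) = (\<integral>\<^sup>+p. \<integral>\<^sup>+s. ?f p (s - p) \<partial>lborel \<partial>lborel)"
  proof (rule nn_integral_cong)
    fix p :: real
    show "(\<integral>\<^sup>+q. ?f p q \<partial>lborel) = (\<integral>\<^sup>+s. ?f p (s - p) \<partial>lborel)"
      by (subst nn_integral_real_affine[where c = 1 and t = "- p"]) (simp_all add: add.commute)
  qed
  also have "\<dots> = (\<integral>\<^sup>+s. \<integral>\<^sup>+p. ?f p (s - p) \<partial>lborel \<partial>lborel)"
    by (rule lborel_pair.Fubini'[symmetric]) measurable
  also have "\<dots> = (\<integral>\<^sup>+s. \<integral>\<^sup>+u. \<psi> (1 / 4 * s * u\<^sup>2) * ennreal (chi_square_density 4 s)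
         * indicator {0..1} u \<partial>lborel \<partial>lborel)"
  proof (rule nn_integral_cong_AE, use AE_lborel_singleton[of "0 :: real"] in eventually_elim)
    fix s :: real assume "s \<noteq> 0"
    then consider "s < 0" | "s > 0" by linarith
    then show "(\<integral>\<^sup>+p. ?f p (s - p) \<partial>lborel) = (\<integral>\<^sup>+u. \<psi> (1 / 4 * s * u\<^sup>2)
        * ennreal (chi_square_density 4 s) * indicator {0..1} u \<partial>lborel)"
    proof cases
      case 1
      then have "?f p (s - p) = 0" for p
        by (auto split: split_indicator)
      then have "(\<integral>\<^sup>+p. ?f p (s - p) \<partial>lborel) = 0"
        by (simp only: nn_integral_const) simp
      with 1 show ?thesis by (simp add: chi_square_density_def)
    next
      case 2
      define k where "k u = \<psi> (1 / 4 * s * u\<^sup>2) * ennreal (exp (- s / 2) / 4)" for u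
      have k [measurable]: "k \<in> borel_measurable borel"
        unfolding k_def by measurable
      have chi: "chi_square_density 4 s = s * exp (- s / 2) / 4"
        using 2 by (simp add: chi_square_density_def Gamma_numeral)
      \<comment> \<open>For fixed \<open>s\<close> the variable \<open>p\<close> runs over \<open>[0, s]\<close>; put \<open>p = s / 2 + (s / 2) u\<close>.\<close>
      have f: "?f (s / 2 + s / 2 * u) (s - (s / 2 + s / 2 * u)) = k u * indicator {-1..1} u" for u
      proof -
        define x where "x = s / 2 + s / 2 * u"
        have sum: "x + (s - x) = s"
          by simp
        have sq: "(x - (s - x))\<^sup>2 / (4 * s) = 1 / 4 * s * u\<^sup>2"
          using 2 by (simp add: x_def field_simps power2_eq_square)
        have "x = s / 2 * (1 + u)" "s - x = s / 2 * (1 - u)"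
          by (simp_all add: x_def distrib_left right_diff_distrib)
        then have "x \<ge> 0 \<longleftrightarrow> u \<ge> -1" "s - x \<ge> 0 \<longleftrightarrow> u \<le> 1"
          using 2 by (auto simp only: zero_le_mult_iff)
        then have ind: "(indicator {0..} x :: ennreal) * indicator {0..} (s - x) = indicator {-1..1} u"
          by (auto split: split_indicator)
        show ?thesis
          unfolding x_def[symmetric] k_def sum sq ind[symmetric] by (simp only: mult_ac)
      qed
      have "(\<integral>\<^sup>+p. ?f p (s - p) \<partial>lborel) = ennreal (s / 2) * (\<integral>\<^sup>+u. k u * indicator {-1..1} u \<partial>lborel)"
        using 2 by (subst nn_integral_real_affine[where c = "s / 2" and t = "s / 2"]) (simp_all only: f, simp_all)
      \<comment> \<open>On the right the point \<open>u = 0\<close> is counted twice, but it is a null set.\<close>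
      also have "(\<integral>\<^sup>+u. k u * indicator {-1..1} u \<partial>lborel)
          = (\<integral>\<^sup>+u. k u * indicator {0..1} u + k (- u) * indicator {0..1} (- u) \<partial>lborel)"
        by (rule nn_integral_cong_AE, use AE_lborel_singleton[of "0 :: real"] in eventually_elim)
           (auto split: split_indicator simp: k_def)
      also have "\<dots> = (\<integral>\<^sup>+u. k u * indicator {0..1} u \<partial>lborel)
          + (\<integral>\<^sup>+u. k (- u) * indicator {0..1} (- u) \<partial>lborel)"
        by (rule nn_integral_add) auto
      also have "(\<integral>\<^sup>+u. k (- u) * indicator {0..1} (- u) \<partial>lborel) = (\<integral>\<^sup>+u. k u * indicator {0..1} u \<partial>lborel)"
        by (subst (2) nn_integral_real_affine[where c = "-1" and t = 0]) simp_all
      also have "ennreal (s / 2) * ((\<integral>\<^sup>+u. k u * indicator {0..1} u \<partial>lborel) + (\<integral>\<^sup>+u. k u * indicator {0..1} u \<partial>lborel))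
          = ennreal s * (\<integral>\<^sup>+u. k u * indicator {0..1} u \<partial>lborel)"
      proof -
        have "ennreal s = ennreal (s / 2) + ennreal (s / 2)"
          using 2 by (subst ennreal_plus[symmetric]) simp_all
        then show ?thesis by (simp only: distrib_left distrib_right)
      qed
      also have "\<dots> = (\<integral>\<^sup>+u. ennreal s * (k u * indicator {0..1} u) \<partial>lborel)"
        by (simp add: nn_integral_cmult)
      finally have integral: "(\<integral>\<^sup>+p. ?f p (s - p) \<partial>lborel)
          = (\<integral>\<^sup>+u. ennreal s * (k u * indicator {0..1} u) \<partial>lborel)" .
      have "ennreal s * (k u * indicator {0..1} u)
          = \<psi> (1 / 4 * s * u\<^sup>2) * ennreal (chi_square_density 4 s) * indicator {0..1} u" for u
      proof -
        have "ennreal (chi_square_density 4 s) = ennreal s * ennreal (exp (- s / 2) / 4)"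
          using 2 by (simp add: chi ennreal_mult'[symmetric])
        then show ?thesis unfolding k_def by (simp only: mult_ac)
      qed
      then show ?thesis unfolding integral by simp
    qed
  qed
  finally show ?thesis .
qed

lemma nn_integral_chi_square_uniform:
  assumes "prob_space N"
    and R: "distributed N lborel R (chi_square_density k)"
    and U: "distr N lborel U = uniform_measure lborel {0..1}"
    and indep: "prob_space.indep_var N borel R borel U"
    and [measurable]: "h \<in> borel_measurable (borel \<Otimes>\<^sub>M borel)"
  shows "(\<integral>\<^sup>+\<omega>. h (R \<omega>, U \<omega>) \<partial>N)
    = (\<integral>\<^sup>+s. \<integral>\<^sup>+u. h (s, u) * ennreal (chi_square_density k s) * indicator {0..1} u \<partial>lborel \<partial>lborel)"
proof -
  interpret N: prob_space N by fact
  have meas [measurable]: "R \<in> borel_measurable N" "U \<in> borel_measurable N"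
    and joint: "distr N borel R \<Otimes>\<^sub>M distr N borel U = distr N (borel \<Otimes>\<^sub>M borel) (\<lambda>\<omega>. (R \<omega>, U \<omega>))"
    using indep unfolding N.indep_var_distribution_eq by auto
  have chi [measurable]: "(\<lambda>s. ennreal (chi_square_density k s)) \<in> borel_measurable borel"
    using R by (simp add: distributed_def)
  have "distr N borel R = distr N lborel R" "distr N borel U = distr N lborel U"
    by (simp_all cong: distr_cong)
  then have laws: "distr N borel R = density lborel (chi_square_density k)"
    "distr N borel U = density lborel (indicator {0..1})"
    using R U by (simp_all add: distributed_def uniform_measure_def divide_ennreal_def)
  interpret U: prob_space "distr N borel U"
    by (rule N.prob_space_distr) measurable
  have "(\<integral>\<^sup>+\<omega>. h (R \<omega>, U \<omega>) \<partial>N) = (\<integral>\<^sup>+x. h x \<partial>(distr N borel R \<Otimes>\<^sub>M distr N borel U))"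
    unfolding joint by (simp add: nn_integral_distr)
  also have "\<dots> = (\<integral>\<^sup>+s. \<integral>\<^sup>+u. h (s, u) \<partial>distr N borel U \<partial>distr N borel R)"
    by (rule U.nn_integral_fst[symmetric]) simp
  also have "\<dots> = (\<integral>\<^sup>+s. ennreal (chi_square_density k s) * (\<integral>\<^sup>+u. indicator {0..1} u * h (s, u) \<partial>lborel) \<partial>lborel)"
    unfolding laws by (simp add: nn_integral_density)
  also have "\<dots> = (\<integral>\<^sup>+s. \<integral>\<^sup>+u. ennreal (chi_square_density k s) * (indicator {0..1} u * h (s, u)) \<partial>lborel \<partial>lborel)"
    by (simp add: nn_integral_cmult)
  finally show ?thesis by (simp only: mult_ac)
qed

section \<open>Kronecker products and a Cholesky factor\<close>

lemma kronecker_mult: "kronecker A B ** kronecker C D = kronecker (A ** C) (B ** D)"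
  by (simp add: vec_eq_iff forall_4 kronecker_def matrix_matrix_mult_def sum_4 sum_2
      block_index_def inner_index_def algebra_simps)

lemma transpose_kronecker: "transpose (kronecker A B) = kronecker (transpose A) (transpose B)"
  by (simp add: vec_eq_iff kronecker_def transpose_def)

lemma kronecker_mat_1: "kronecker (mat 1) (mat 1) = mat 1"
  by (simp add: vec_eq_iff forall_4 kronecker_def mat_def block_index_def inner_index_def)

lemma pos_def_matrix_cholesky_2:
  fixes S :: "real ^ 2 ^ 2"
  assumes "pos_def_matrix S"
  obtains L :: "real ^ 2 ^ 2" where "L ** transpose L = S" "invertible L"
proof -
  define a b d where "a = S $ 1 $ 1" and "b = S $ 1 $ 2" and "d = S $ 2 $ 2"
  have sym: "S $ 2 $ 1 = b"
  proof -
    have "transpose S $ 1 $ 2 = S $ 1 $ 2"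
      using assms by (simp add: pos_def_matrix_def)
    then show ?thesis by (simp add: transpose_def b_def)
  qed
  have form: "x \<bullet> (S *v x) = a * (x $ 1)\<^sup>2 + 2 * b * (x $ 1) * (x $ 2) + d * (x $ 2)\<^sup>2" for x
    unfolding a_def b_def d_def inner_vec_def
    by (simp add: matrix_vector_mult_def sum_2 sym b_def power2_eq_square algebra_simps)
  have pos: "0 < a * p\<^sup>2 + 2 * b * p * q + d * q\<^sup>2" if "p \<noteq> 0 \<or> q \<noteq> 0" for p q
  proof -
    have "(\<chi> i. if i = 1 then p else q) \<noteq> (0 :: real ^ 2)"
      using that by (auto simp: vec_eq_iff forall_2)
    then have "0 < (\<chi> i. if i = 1 then p else q) \<bullet> (S *v (\<chi> i. if i = 1 then p else q))"
      using assms unfolding pos_def_matrix_def by blast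
    then show ?thesis unfolding form by simp
  qed
  have a: "a > 0"
    using pos[of 1 0] by simp
  \<comment> \<open>The vector \<open>(-b, a)\<close> isolates the determinant.\<close>
  have "0 < a * (a * d - b\<^sup>2)"
    using pos[of "- b" a] a by (simp add: power2_eq_square algebra_simps)
  with a have det: "a * d - b\<^sup>2 > 0"
    by (simp add: zero_less_mult_iff)
  define L :: "real ^ 2 ^ 2" where
    "L = (\<chi> i j. if i = 1 then (if j = 1 then sqrt a else 0)
                 else (if j = 1 then b / sqrt a else sqrt ((a * d - b\<^sup>2) / a)))"
  have "b / sqrt a * (b / sqrt a) + (a * d - b\<^sup>2) / a = d"
    using a by (simp add: field_simps power2_eq_square)
  with a det have "L ** transpose L = S"
    by (simp add: vec_eq_iff forall_2 L_def matrix_matrix_mult_def transpose_def sum_2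
        sym a_def[symmetric] b_def[symmetric] d_def[symmetric])
  moreover have "det L \<noteq> 0"
    using a det by (simp add: det_2 L_def)
  then have "invertible L"
    by (simp add: invertible_det_nz)
  ultimately show ?thesis using that by blast
qed

section \<open>The determinant form and its gradient\<close>

text \<open>The determinant of the matrix with rows \<open>(x\<^sub>1, x\<^sub>2)\<close> and \<open>(x\<^sub>3, x\<^sub>4)\<close>.\<close>
definition det_form :: "real ^ 4 \<Rightarrow> real" where
  "det_form x = x $ 1 * x $ 4 - x $ 2 * x $ 3"

text \<open>The matrix with rows \<open>(0, 1)\<close> and \<open>(-1, 0)\<close>.\<close>
definition symplectic_2 :: "real ^ 2 ^ 2" where
  "symplectic_2 = (\<chi> i j. if i = j then 0 else if i = 1 then 1 else - 1)"

text \<open>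
  The map \<open>(x\<^sub>1, x\<^sub>2, x\<^sub>3, x\<^sub>4) \<mapsto> (x\<^sub>4, -x\<^sub>3, -x\<^sub>2, x\<^sub>1)\<close>, which sends a \<open>2 \<times> 2\<close> matrix to its cofactor
  matrix. Writing it as a Kronecker product makes its behaviour under \<open>L\<^sub>1 \<otimes> L\<^sub>2\<close> a matter of \<open>2 \<times> 2\<close>
  matrices.
\<close>
definition cofactor_map :: "real ^ 4 ^ 4" where
  "cofactor_map = kronecker symplectic_2 symplectic_2"

lemma cofactor_map_component:
  "(cofactor_map *v x) $ 1 = x $ 4" "(cofactor_map *v x) $ 2 = - x $ 3"
  "(cofactor_map *v x) $ 3 = - x $ 2" "(cofactor_map *v x) $ 4 = x $ 1"
  by (simp_all add: cofactor_map_def symplectic_2_def kronecker_def matrix_vector_mult_def sum_4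
      block_index_def inner_index_def)

lemma gradient_det_form: "gradient det_form x = cofactor_map *v x"
proof (rule gradient_eqI)
  have "(det_form has_derivative
      (\<lambda>h. (x $ 1 * h $ 4 + h $ 1 * x $ 4) - (x $ 2 * h $ 3 + h $ 2 * x $ 3))) (at x)"
    unfolding det_form_def[abs_def]
    by (intro derivative_intros bounded_linear_imp_has_derivative bounded_linear_vec_nth)
  then show "GDERIV det_form x :> cofactor_map *v x"
    unfolding gderiv_def inner_vec_def sum_4 cofactor_map_component
    by (simp add: algebra_simps)
qed

lemma det_form_eq_inner: "det_form x = 1 / 2 * (x \<bullet> (cofactor_map *v x))"
  unfolding inner_vec_def sum_4 cofactor_map_component by (simp add: det_form_def algebra_simps)

lemma norm_cofactor_map: "norm (cofactor_map *v x) = norm x"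
  unfolding norm_eq_sqrt_inner inner_vec_def sum_4 cofactor_map_component by (simp add: algebra_simps)

lemma symplectic_2_congruence: "transpose A ** symplectic_2 ** A = det A *\<^sub>R symplectic_2"
  by (simp add: vec_eq_iff forall_2 symplectic_2_def matrix_matrix_mult_def transpose_def sum_2 det_2
      algebra_simps)

lemma kronecker_scaleR: "kronecker (a *\<^sub>R A) (b *\<^sub>R B) = (a * b) *\<^sub>R kronecker A B"
  by (simp add: vec_eq_iff kronecker_def)

lemma cofactor_map_congruence:
  "transpose (kronecker A B) ** cofactor_map ** kronecker A B = (det A * det B) *\<^sub>R cofactor_map"
  unfolding cofactor_map_def transpose_kronecker kronecker_mult symplectic_2_congruence
    kronecker_scaleR ..

text \<open>
  Both sides vanish at \<open>y = 0\<close>, by the convention for division.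
\<close>
lemma wald_det_form_kronecker:
  assumes "L1 ** transpose L1 = S1" "L2 ** transpose L2 = S2" "invertible L1" "invertible L2"
  shows "wald det_form (kronecker S1 S2) (kronecker L1 L2 *v y) = (det_form y)\<^sup>2 / (norm y)\<^sup>2"
proof -
  let ?L = "kronecker L1 L2"
  define c where "c = det L1 * det L2"
  have c: "c \<noteq> 0"
    using assms(3,4) by (simp add: c_def invertible_det_nz)
  have S: "kronecker S1 S2 = ?L ** transpose ?L"
    by (simp add: transpose_kronecker kronecker_mult assms)
  have adj: "transpose ?L *v (cofactor_map *v (?L *v y)) = c *\<^sub>R (cofactor_map *v y)"
    by (simp add: matrix_vector_mul_assoc matrix_mul_assoc cofactor_map_congruence c_def
        scaleR_matrix_vector_assoc)
  have adjoint: "(?L *v v) \<bullet> w = v \<bullet> (transpose ?L *v w)" for v w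
    by (metis dot_lmul_matrix vector_transpose_matrix transpose_transpose)
  have num: "det_form (?L *v y) = c * det_form y"
    unfolding det_form_eq_inner adjoint adj by simp
  define g where "g = cofactor_map *v (?L *v y)"
  have "g \<bullet> (kronecker S1 S2 *v g) = (transpose ?L *v g) \<bullet> (transpose ?L *v g)"
    unfolding S matrix_vector_mul_assoc[symmetric] by (subst inner_commute) (rule adjoint)
  also have "\<dots> = c\<^sup>2 * (norm y)\<^sup>2"
    unfolding g_def adj by (simp add: power2_norm_eq_inner[symmetric] norm_cofactor_map power_mult_distrib)
  finally show ?thesis
    unfolding wald_def gradient_det_form num g_def[symmetric] using c
    by (simp add: power_mult_distrib)
qed

section \<open>The law of the statistic\<close>

text \<open>
  In the orthonormal coordinates \<open>(z\<^sub>1 + z\<^sub>4) / \<surd>2\<close>, \<open>(z\<^sub>2 - z\<^sub>3) / \<surd>2\<close>, \<open>(z\<^sub>1 - z\<^sub>4) / \<surd>2\<close>,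
  \<open>(z\<^sub>2 + z\<^sub>3) / \<surd>2\<close> twice the determinant is the difference of the two sums of squares.
\<close>
lemma distr_std_normal_vec_det_form:
  "distr std_normal_vec borel (\<lambda>z :: real ^ 4. (det_form z)\<^sup>2 / (norm z)\<^sup>2)
   = distr std_normal_vec borel (\<lambda>z :: real ^ 4. (((z $ 1)\<^sup>2 + (z $ 2)\<^sup>2) - ((z $ 3)\<^sup>2 + (z $ 4)\<^sup>2))\<^sup>2
       / (4 * (((z $ 1)\<^sup>2 + (z $ 2)\<^sup>2) + ((z $ 3)\<^sup>2 + (z $ 4)\<^sup>2))))"
    (is "distr _ _ ?g = distr _ _ ?h")
proof -
  define k :: "real ^ 4 \<Rightarrow> real ^ 4" where
    "k z = (\<chi> i. if i = 1 then (z $ 1 + z $ 4) / sqrt 2 else if i = 2 then (z $ 2 - z $ 3) / sqrt 2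
                 else if i = 3 then (z $ 1 - z $ 4) / sqrt 2 else (z $ 2 + z $ 3) / sqrt 2)" for z
  have k: "k z $ 1 = (z $ 1 + z $ 4) / sqrt 2" "k z $ 2 = (z $ 2 - z $ 3) / sqrt 2"
    "k z $ 3 = (z $ 1 - z $ 4) / sqrt 2" "k z $ 4 = (z $ 2 + z $ 3) / sqrt 2" for z
    by (simp_all add: k_def)
  have "(norm (k z))\<^sup>2 = (norm z)\<^sup>2" for z
    unfolding norm_sq_4 k power_divide by (simp add: power2_eq_square field_simps)
  then have norm_k: "norm (k z) = norm z" for z
    by (metis norm_ge_zero power2_eq_iff_nonneg)
  have "linear k"
    by (rule linearI) (simp_all add: vec_eq_iff forall_4 k add_divide_distrib diff_divide_distrib algebra_simps)
  with norm_k have orth: "orthogonal_transformation k"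
    by (simp add: orthogonal_transformation)
  then have k_meas [measurable]: "k \<in> borel_measurable borel"
    by (rule orthogonal_transformation_borel_measurable)
  have "?h (k z) = ?g z" for z
  proof -
    have "((k z $ 1)\<^sup>2 + (k z $ 2)\<^sup>2) - ((k z $ 3)\<^sup>2 + (k z $ 4)\<^sup>2) = 2 * det_form z"
      unfolding k power_divide det_form_def by (simp add: power2_eq_square field_simps)
    then show ?thesis
      unfolding norm_sq_4[symmetric] norm_k by (simp add: power_mult_distrib)
  qed
  then have "distr std_normal_vec borel ?g = distr std_normal_vec borel (?h \<circ> k)"
    by (simp add: comp_def)
  also have "\<dots> = distr (distr std_normal_vec borel k) borel ?h"
    by (rule distr_distr[symmetric]) (simp_all add: std_normal_vec_def)
  finally show ?thesis
    unfolding distr_std_normal_vec_orthogonal[OF orth] .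
qed

lemma distr_wald_det_form:
  assumes "pos_def_matrix S1" "pos_def_matrix S2" "multivariate_normal M 0 (kronecker S1 S2) X"
  shows "distr M borel (\<lambda>\<omega>. wald det_form (kronecker S1 S2) (X \<omega>))
       = distr std_normal_vec borel (\<lambda>z. (det_form z)\<^sup>2 / (norm z)\<^sup>2)"
proof -
  let ?S = "kronecker S1 S2" and ?g = "\<lambda>z. (det_form z)\<^sup>2 / (norm z)\<^sup>2"
  obtain A :: "real ^ 4 ^ 4" where A: "A ** transpose A = ?S"
    and X: "X \<in> borel_measurable M" "distr M borel X = distr std_normal_vec borel (\<lambda>z. A *v z)"
    using assms(3) by (auto simp: multivariate_normal_def)
  obtain L1 :: "real ^ 2 ^ 2" where L1: "L1 ** transpose L1 = S1" "invertible L1"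
    using assms(1) by (rule pos_def_matrix_cholesky_2)
  obtain L2 :: "real ^ 2 ^ 2" where L2: "L2 ** transpose L2 = S2" "invertible L2"
    using assms(2) by (rule pos_def_matrix_cholesky_2)
  obtain P1 where P1: "L1 ** P1 = mat 1" "P1 ** L1 = mat 1"
    using L1(2) unfolding invertible_def by blast
  obtain P2 where P2: "L2 ** P2 = mat 1" "P2 ** L2 = mat 1"
    using L2(2) unfolding invertible_def by blast
  define L where "L = kronecker L1 L2"
  define P where "P = kronecker P1 P2"
  have LP: "L ** P = mat 1" and PL: "P ** L = mat 1"
    by (simp_all add: L_def P_def kronecker_mult P1 P2 kronecker_mat_1)
  have S: "?S = L ** transpose L"
    by (simp add: L_def transpose_kronecker kronecker_mult L1 L2)
  \<comment> \<open>\<open>A\<close> and \<open>L\<close> are two square roots of the same matrix, so they differ by an orthogonal factor.\<close>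
  define Q where "Q = P ** A"
  have "Q ** transpose Q = P ** (A ** transpose A) ** transpose P"
    by (simp add: Q_def matrix_transpose_mul matrix_mul_assoc)
  also have "\<dots> = (P ** L) ** transpose (P ** L)"
    unfolding A S by (simp only: matrix_transpose_mul matrix_mul_assoc)
  also have "\<dots> = mat 1"
    by (simp add: PL transpose_mat)
  finally have "orthogonal_matrix Q"
    using matrix_left_right_inverse orthogonal_matrix_def by blast
  then have orth: "orthogonal_transformation ((*v) Q)"
    by (simp add: orthogonal_transformation_matrix)
  have wald_A: "wald det_form ?S (A *v z) = ?g (Q *v z)" for z
  proof -
    have "A = L ** Q"
      by (simp add: Q_def matrix_mul_assoc LP)
    then show ?thesis
      using wald_det_form_kronecker[OF L1(1) L2(1) L1(2) L2(2), of "Q *v z"]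
      by (simp add: L_def matrix_vector_mul_assoc)
  qed
  have det_form_meas [measurable]: "det_form \<in> borel_measurable borel"
    unfolding det_form_def[abs_def] by measurable
  have lin_meas [measurable]: "(*v) B \<in> borel_measurable borel" for B :: "real ^ 4 ^ 4"
    by (intro borel_measurable_continuous_onI continuous_intros)
  have wald_meas [measurable]: "wald det_form ?S \<in> borel_measurable borel"
    unfolding wald_def[abs_def] gradient_det_form by measurable
  have "distr M borel (\<lambda>\<omega>. wald det_form ?S (X \<omega>)) = distr (distr M borel X) borel (wald det_form ?S)"
    using X(1) by (simp add: distr_distr comp_def)
  also have "\<dots> = distr std_normal_vec borel (\<lambda>z. ?g (Q *v z))"
    unfolding X(2) by (subst distr_distr) (simp_all add: comp_def wald_A std_normal_vec_def)
  also have "\<dots> = distr (distr std_normal_vec borel ((*v) Q)) borel ?g"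
    by (subst distr_distr) (simp_all add: comp_def std_normal_vec_def)
  finally show ?thesis
    unfolding distr_std_normal_vec_orthogonal[OF orth] .
qed

lemma emeasure_distr_eq_nn_integral:
  assumes "f \<in> measurable M N" "B \<in> sets N"
  shows "emeasure (distr M N f) B = (\<integral>\<^sup>+x. indicator B (f x) \<partial>M)"
  using assms nn_integral_distr[of f M N "indicator B"] by simp

theorem theorem4p2:
  fixes \<Sigma>1 \<Sigma>2 :: "real ^ 2 ^ 2"
    and M :: "'a measure" and X :: "'a \<Rightarrow> real ^ 4"
    and N :: "'b measure" and Rsq U :: "'b \<Rightarrow> real"
  assumes "pos_def_matrix \<Sigma>1" and "pos_def_matrix \<Sigma>2"
    and "prob_space M"
    and "multivariate_normal M 0 (kronecker \<Sigma>1 \<Sigma>2) X"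
    and "prob_space N"
    and "distributed N lborel Rsq (chi_square_density 4)"
    and "distr N lborel U = uniform_measure lborel {0..1}"
    and "prob_space.indep_var N borel Rsq borel U"
  shows "distr M borel
           (\<lambda>\<omega>. wald (\<lambda>x :: real ^ 4. x $ 1 * x $ 4 - x $ 2 * x $ 3) (kronecker \<Sigma>1 \<Sigma>2) (X \<omega>))
       = distr N borel (\<lambda>\<omega>. 1 / 4 * Rsq \<omega> * (U \<omega>)\<^sup>2)"
proof -
  let ?h = "\<lambda>z :: real ^ 4. (((z $ 1)\<^sup>2 + (z $ 2)\<^sup>2) - ((z $ 3)\<^sup>2 + (z $ 4)\<^sup>2))\<^sup>2
       / (4 * (((z $ 1)\<^sup>2 + (z $ 2)\<^sup>2) + ((z $ 3)\<^sup>2 + (z $ 4)\<^sup>2)))"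
  let ?T = "\<lambda>(p :: real, q). (p - q)\<^sup>2 / (4 * (p + q))"
  have "distr std_normal_vec borel ?h = distr N borel (\<lambda>\<omega>. 1 / 4 * Rsq \<omega> * (U \<omega>)\<^sup>2)"
  proof (rule measure_eqI)
    interpret N: prob_space N by fact
    have [measurable]: "Rsq \<in> borel_measurable N" "U \<in> borel_measurable N"
      using assms(8) unfolding N.indep_var_distribution_eq by auto
    have [measurable]: "?h \<in> borel_measurable std_normal_vec"
      by (simp add: std_normal_vec_def)
    fix B assume "B \<in> sets (distr std_normal_vec borel ?h)"
    then have [measurable]: "B \<in> sets borel" by simp
    have "emeasure (distr std_normal_vec borel ?h) B = (\<integral>\<^sup>+z. indicator B (?h z) \<partial>std_normal_vec)"
      by (rule emeasure_distr_eq_nn_integral) measurable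
    also have "\<dots> = (\<integral>\<^sup>+s. \<integral>\<^sup>+u. indicator B (1 / 4 * s * u\<^sup>2) * ennreal (chi_square_density 4 s)
         * indicator {0..1} u \<partial>lborel \<partial>lborel)"
      using nn_integral_std_normal_vec_4[of "\<lambda>x. indicator B (?T x)"]
        nn_integral_quadrant_sum_ratio[of "indicator B"] by simp
    also have "\<dots> = (\<integral>\<^sup>+\<omega>. indicator B (1 / 4 * Rsq \<omega> * (U \<omega>)\<^sup>2) \<partial>N)"
      using nn_integral_chi_square_uniform[OF assms(5-8), of "\<lambda>(s, u). indicator B (1 / 4 * s * u\<^sup>2)"]
      by simp
    also have "\<dots> = emeasure (distr N borel (\<lambda>\<omega>. 1 / 4 * Rsq \<omega> * (U \<omega>)\<^sup>2)) B"
      by (rule emeasure_distr_eq_nn_integral[symmetric]) measurable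
    finally show "emeasure (distr std_normal_vec borel ?h) B
        = emeasure (distr N borel (\<lambda>\<omega>. 1 / 4 * Rsq \<omega> * (U \<omega>)\<^sup>2)) B" .
  qed simp
  then show ?thesis
    using distr_wald_det_form[OF assms(1,2,4)] distr_std_normal_vec_det_form
    by (simp add: det_form_def[abs_def])
qed

end
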